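(* Let $M$ be a monoid and let $\mathcal{C}(M)$ be the space of congruence relations on $M$. Then the set of congruence relations $\gamma$ on $M$ such that the quotient monoid $M/\gamma$ is surjunctive is closed in $\mathcal{C}(M)$.
   Context: A congruence relation on a monoid $M$ is an equivalence relation $\gamma\subset M\times M$ such that $(m_1,m_1'),(m_2,m_2')\in\gamma$ implies $(m_1m_2,m_1'm_2')\in\gamma$; the quotient set $M/\gamma$ is then a monoid with $[m][m']=[mm']$. The set $\mathcal{C}(M)$ of all congruence relations on $M$ is viewed as a subset of $\mathcal{P}(M\times M)=\{0,1\}^{M\times M}$ and is equipped with the topology (and uniform structure) induced by the product of the discrete topologies (uniform structures); a base of entourages consists of the sets $\{(\gamma_1,\gamma_2)\in\mathcal{C}(M)\times\mathcal{C}(M):\gamma_1\cap F=\gamma_2\cap F\}$, $F$ running over the finite subsets of $M\times M$. Let $N$ be a monoid and $A$ a set. The set $A^N$ of all maps $x\colon N\to A$ carries the shift action of $N$ given by $(nx)(n') := x(n'n)$ for $n,n'\in N$, and the prodiscrete uniform structure, for which a base of entourages is given by the sets $W_F := \{(x,y)\in A^N\times A^N : x|_F = y|_F\}$, $F$ running over all finite subsets of $N$. A cellular automaton over $N$ with alphabet $A$ is a map $\tau\colon A^N\to A^N$ that is $N$-equivariant ($\tau(nx)=n\tau(x)$ for all $n\in N$, $x\in A^N$) and uniformly continuous. The monoid $N$ is called surjunctive if, for every finite set $A$, every injective cellular automaton $\tau\colon A^N\to A^N$ is surjective. *)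

theory Defs
  imports "HOL-Algebra.Group" "HOL-Analysis.Function_Topology"
begin

section \<open>Congruence relations and quotient monoids\<close>

definition congruence_on :: "('a, 'b) monoid_scheme \<Rightarrow> 'a rel \<Rightarrow> bool" where
  "congruence_on M \<gamma> \<longleftrightarrow>
     equiv (carrier M) \<gamma> \<and>
     (\<forall>m1 m1' m2 m2'. (m1, m1') \<in> \<gamma> \<longrightarrow> (m2, m2') \<in> \<gamma> \<longrightarrow>
        (m1 \<otimes>\<^bsub>M\<^esub> m2, m1' \<otimes>\<^bsub>M\<^esub> m2') \<in> \<gamma>)"

definition congruences :: "('a, 'b) monoid_scheme \<Rightarrow> 'a rel set" where
  "congruences M = {\<gamma>. congruence_on M \<gamma>}"

text \<open>The union in the multiplication is the usual way of writing an operation on classes without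
  choosing representatives: for a congruence all the classes in the union coincide.\<close>

definition quotient_monoid :: "('a, 'b) monoid_scheme \<Rightarrow> 'a rel \<Rightarrow> 'a set monoid" where
  "quotient_monoid M \<gamma> =
     \<lparr>carrier = carrier M // \<gamma>,
      mult = (\<lambda>X Y. \<Union>x\<in>X. \<Union>y\<in>Y. \<gamma> `` {x \<otimes>\<^bsub>M\<^esub> y}),
      one = \<gamma> `` {\<one>\<^bsub>M\<^esub>}\<rparr>"

lemma quotient_monoid_mult:
  assumes "congruence_on M \<gamma>" and "m \<in> carrier M" and "m' \<in> carrier M"
  shows "\<gamma> `` {m} \<otimes>\<^bsub>quotient_monoid M \<gamma>\<^esub> \<gamma> `` {m'} = \<gamma> `` {m \<otimes>\<^bsub>M\<^esub> m'}"
proof -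
  have eq: "equiv (carrier M) \<gamma>"
    using assms(1) by (simp add: congruence_on_def)
  have "congruent2 \<gamma> \<gamma> (\<lambda>x y. \<gamma> `` {x \<otimes>\<^bsub>M\<^esub> y})"
  proof (rule congruent2I')
    fix y1 z1 y2 z2 assume "(y1, z1) \<in> \<gamma>" "(y2, z2) \<in> \<gamma>"
    then have "(y1 \<otimes>\<^bsub>M\<^esub> y2, z1 \<otimes>\<^bsub>M\<^esub> z2) \<in> \<gamma>"
      using assms(1) by (simp add: congruence_on_def)
    then show "\<gamma> `` {y1 \<otimes>\<^bsub>M\<^esub> y2} = \<gamma> `` {z1 \<otimes>\<^bsub>M\<^esub> z2}"
      by (rule equiv_class_eq[OF eq])
  qed
  from UN_equiv_class2[OF eq eq this assms(2,3)] show ?thesis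
    by (simp add: quotient_monoid_def)
qed

lemma monoid_quotient_monoid:
  assumes "monoid M" and "congruence_on M \<gamma>"
  shows "monoid (quotient_monoid M \<gamma>)"
proof -
  interpret monoid M by fact
  let ?Q = "quotient_monoid M \<gamma>"
  note mult = quotient_monoid_mult[OF assms(2)]
  have one: "\<one>\<^bsub>?Q\<^esub> = \<gamma> `` {\<one>\<^bsub>M\<^esub>}"
    by (simp add: quotient_monoid_def)
  have cls: "\<gamma> `` {m} \<in> carrier ?Q" if "m \<in> carrier M" for m
    using that by (simp add: quotient_monoid_def quotientI)
  have rep: "\<exists>m\<in>carrier M. X = \<gamma> `` {m}" if "X \<in> carrier ?Q" for X
    using that by (auto simp: quotient_monoid_def quotient_def)
  show ?thesis
  proof (rule monoidI)
    fix X Y assume "X \<in> carrier ?Q" "Y \<in> carrier ?Q"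
    from this[THEN rep] show "X \<otimes>\<^bsub>?Q\<^esub> Y \<in> carrier ?Q"
      by (elim bexE) (simp only: mult cls m_closed)
  next
    show "\<one>\<^bsub>?Q\<^esub> \<in> carrier ?Q"
      by (simp only: one cls one_closed)
  next
    fix X Y Z assume "X \<in> carrier ?Q" "Y \<in> carrier ?Q" "Z \<in> carrier ?Q"
    from this[THEN rep] show "X \<otimes>\<^bsub>?Q\<^esub> Y \<otimes>\<^bsub>?Q\<^esub> Z = X \<otimes>\<^bsub>?Q\<^esub> (Y \<otimes>\<^bsub>?Q\<^esub> Z)"
      by (elim bexE) (simp only: mult m_closed m_assoc)
  next
    fix X assume "X \<in> carrier ?Q"
    from rep[OF this] show "\<one>\<^bsub>?Q\<^esub> \<otimes>\<^bsub>?Q\<^esub> X = X"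
      by (elim bexE) (simp only: one mult one_closed l_one)
  next
    fix X assume "X \<in> carrier ?Q"
    from rep[OF this] show "X \<otimes>\<^bsub>?Q\<^esub> \<one>\<^bsub>?Q\<^esub> = X"
      by (elim bexE) (simp only: one mult one_closed r_one)
  qed
qed

section \<open>The space of congruence relations\<close>

text \<open>A congruence is identified with its indicator function on \<open>carrier M \<times> carrier M\<close>, and the
  product topology on functions into the discrete two-point space is pulled back along this
  identification.\<close>

definition congruence_space :: "('a, 'b) monoid_scheme \<Rightarrow> 'a rel topology" where
  "congruence_space M =
     pullback_topology (congruences M)
       (\<lambda>\<gamma>. \<lambda>p\<in>carrier M \<times> carrier M. p \<in> \<gamma>)
       (product_topology (\<lambda>_. discrete_topology (UNIV :: bool set)) (carrier M \<times> carrier M))"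

lemma topspace_congruence_space: "topspace (congruence_space M) = congruences M"
  by (auto simp: congruence_space_def topspace_pullback_topology)

lemma openin_congruence_space:
  "openin (congruence_space M) S \<longleftrightarrow>
     S \<subseteq> congruences M \<and>
     (\<forall>\<gamma>\<in>S. \<exists>F. finite F \<and> F \<subseteq> carrier M \<times> carrier M \<and>
        (\<forall>\<delta>\<in>congruences M. \<gamma> \<inter> F = \<delta> \<inter> F \<longrightarrow> \<delta> \<in> S))" (is "?L \<longleftrightarrow> ?R")
proof
  let ?I = "carrier M \<times> carrier M"
  let ?T = "product_topology (\<lambda>_. discrete_topology (UNIV :: bool set)) ?I"
  let ?c = "\<lambda>\<gamma>. \<lambda>p\<in>?I. p \<in> \<gamma>"
  {
    assume ?L
    then obtain U where U: "openin ?T U" "S = ?c -` U \<inter> congruences M"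
      by (auto simp: congruence_space_def openin_pullback_topology)
    show ?R
    proof (intro conjI ballI)
      fix \<gamma> assume "\<gamma> \<in> S"
      then have "?c \<gamma> \<in> U" using U by auto
      with U(1) obtain V where V: "finite {i \<in> ?I. V i \<noteq> (UNIV :: bool set)}"
        "?c \<gamma> \<in> Pi\<^sub>E ?I V" "Pi\<^sub>E ?I V \<subseteq> U"
        unfolding openin_product_topology_alt topspace_discrete_topology by blast
      define F where "F = {i \<in> ?I. V i \<noteq> UNIV}"
      have "\<delta> \<in> S" if \<delta>: "\<delta> \<in> congruences M" "\<gamma> \<inter> F = \<delta> \<inter> F" for \<delta>
      proof -
        have "?c \<delta> i \<in> V i" if i: "i \<in> ?I" for i
        proof (cases "i \<in> F")
          case True
          then have "(i \<in> \<gamma>) = (i \<in> \<delta>)" using \<delta>(2) by blast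
          moreover have "?c \<gamma> i \<in> V i" using V(2) i by (rule PiE_mem)
          ultimately show ?thesis using i by (simp only: restrict_apply')
        next
          case False
          then have "V i = UNIV" using i unfolding F_def by blast
          then show ?thesis by simp
        qed
        then have "?c \<delta> \<in> Pi\<^sub>E ?I V" by (simp only: PiE_iff restrict_extensional) blast
        then show ?thesis using U(2) V(3) \<delta>(1) by blast
      qed
      then show "\<exists>F. finite F \<and> F \<subseteq> ?I \<and>
          (\<forall>\<delta>\<in>congruences M. \<gamma> \<inter> F = \<delta> \<inter> F \<longrightarrow> \<delta> \<in> S)"
        using V(1) unfolding F_def[symmetric] by (intro exI[of _ F]) (auto simp: F_def)
    qed (use U in blast)
  next
    assume R: ?R
    define W where "W F \<gamma> = Pi\<^sub>E ?I (\<lambda>i. if i \<in> F then {i \<in> \<gamma>} else UNIV)" for F and \<gamma> :: "'a rel"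
    have W: "?c \<delta> \<in> W F \<gamma> \<longleftrightarrow> \<gamma> \<inter> F = \<delta> \<inter> F" if "F \<subseteq> ?I" for F \<gamma> \<delta>
    proof -
      have "?c \<delta> \<in> W F \<gamma> \<longleftrightarrow> (\<forall>i\<in>F. (i \<in> \<delta>) = (i \<in> \<gamma>))"
        using that unfolding W_def PiE_iff by (fastforce split: if_splits)
      then show ?thesis by blast
    qed
    have oW: "openin ?T (W F \<gamma>)" if "finite F" for F \<gamma>
      unfolding W_def
      by (subst openin_PiE_gen) (auto intro: finite_subset[OF _ that] split: if_splits)
    from R obtain F where F: "\<And>\<gamma>. \<gamma> \<in> S \<Longrightarrow> finite (F \<gamma>) \<and> F \<gamma> \<subseteq> ?I \<and>
        (\<forall>\<delta>\<in>congruences M. \<gamma> \<inter> F \<gamma> = \<delta> \<inter> F \<gamma> \<longrightarrow> \<delta> \<in> S)"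
      by metis
    have "openin ?T (\<Union>\<gamma>\<in>S. W (F \<gamma>) \<gamma>)"
      by (intro openin_Union ballI) (auto intro!: oW dest: F)
    moreover have "S = ?c -` (\<Union>\<gamma>\<in>S. W (F \<gamma>) \<gamma>) \<inter> congruences M"
    proof (intro equalityI subsetI)
      fix \<gamma> assume "\<gamma> \<in> S"
      then show "\<gamma> \<in> ?c -` (\<Union>\<gamma>\<in>S. W (F \<gamma>) \<gamma>) \<inter> congruences M"
        using R F[of \<gamma>] W[of "F \<gamma>" \<gamma> \<gamma>] by auto
    next
      fix \<delta> assume "\<delta> \<in> ?c -` (\<Union>\<gamma>\<in>S. W (F \<gamma>) \<gamma>) \<inter> congruences M"
      then obtain \<gamma> where "\<gamma> \<in> S" "?c \<delta> \<in> W (F \<gamma>) \<gamma>" "\<delta> \<in> congruences M"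
        by auto
      then show "\<delta> \<in> S" using F[of \<gamma>] W[of "F \<gamma>" \<delta> \<gamma>] by auto
    qed
    ultimately show ?L
      unfolding congruence_space_def openin_pullback_topology by (intro exI conjI)
  }
qed

section \<open>Cellular automata and surjunctive monoids\<close>

definition configs :: "('n, 'b) monoid_scheme \<Rightarrow> 'c set \<Rightarrow> ('n \<Rightarrow> 'c) set" where
  "configs N A = (carrier N \<rightarrow>\<^sub>E A)"

definition shift :: "('n, 'b) monoid_scheme \<Rightarrow> 'n \<Rightarrow> ('n \<Rightarrow> 'c) \<Rightarrow> ('n \<Rightarrow> 'c)" where
  "shift N n x = (\<lambda>n'\<in>carrier N. x (n' \<otimes>\<^bsub>N\<^esub> n))"

definition prodiscrete_entourage ::
    "('n, 'b) monoid_scheme \<Rightarrow> 'c set \<Rightarrow> 'n set \<Rightarrow> (('n \<Rightarrow> 'c) \<times> ('n \<Rightarrow> 'c)) set" where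
  "prodiscrete_entourage N A F =
     {(x, y) \<in> configs N A \<times> configs N A. restrict x F = restrict y F}"

definition prodiscrete_uniformity ::
    "('n, 'b) monoid_scheme \<Rightarrow> 'c set \<Rightarrow> (('n \<Rightarrow> 'c) \<times> ('n \<Rightarrow> 'c)) filter" where
  "prodiscrete_uniformity N A =
     (INF F\<in>{F. finite F \<and> F \<subseteq> carrier N}. principal (prodiscrete_entourage N A F))"

text \<open>Uniform continuity is phrased with filters as in the type class \<open>uniform_space\<close>, which is not
  applicable itself because the configuration space is a proper subset of its type.\<close>

definition cellular_automaton ::
    "('n, 'b) monoid_scheme \<Rightarrow> 'c set \<Rightarrow> (('n \<Rightarrow> 'c) \<Rightarrow> ('n \<Rightarrow> 'c)) \<Rightarrow> bool" where
  "cellular_automaton N A \<tau> \<longleftrightarrow>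
     \<tau> \<in> configs N A \<rightarrow> configs N A \<and>
     (\<forall>n\<in>carrier N. \<forall>x\<in>configs N A. \<tau> (shift N n x) = shift N n (\<tau> x)) \<and>
     filterlim (\<lambda>(x, y). (\<tau> x, \<tau> y)) (prodiscrete_uniformity N A) (prodiscrete_uniformity N A)"

text \<open>A definition cannot quantify over the type of the alphabet. Finite subsets of the naturals
  represent all finite sets up to bijection; the lemma \<open>surjunctiveD\<close> below recovers the property
  for finite alphabets of every type.\<close>

definition surjunctive :: "('n, 'b) monoid_scheme \<Rightarrow> bool" where
  "surjunctive N \<longleftrightarrow>
     (\<forall>A :: nat set. finite A \<longrightarrow>
        (\<forall>\<tau>. cellular_automaton N A \<tau> \<longrightarrow> inj_on \<tau> (configs N A) \<longrightarrow>
              \<tau> ` configs N A = configs N A))"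

lemma eventually_prodiscrete_uniformity:
  "eventually P (prodiscrete_uniformity N A) \<longleftrightarrow>
     (\<exists>F. finite F \<and> F \<subseteq> carrier N \<and> (\<forall>p\<in>prodiscrete_entourage N A F. P p))"
proof -
  have anti: "prodiscrete_entourage N A G \<subseteq> prodiscrete_entourage N A F" if "F \<subseteq> G" for F G
    using that unfolding prodiscrete_entourage_def by (auto simp: fun_eq_iff restrict_def)
  show ?thesis
    unfolding prodiscrete_uniformity_def
  proof (subst eventually_INF_base)
    show "{F. finite F \<and> F \<subseteq> carrier N} \<noteq> {}" by blast
  next
    fix F G assume "F \<in> {F. finite F \<and> F \<subseteq> carrier N}" "G \<in> {F. finite F \<and> F \<subseteq> carrier N}"
    then show "\<exists>H\<in>{F. finite F \<and> F \<subseteq> carrier N}. principal (prodiscrete_entourage N A H) \<le>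
        inf (principal (prodiscrete_entourage N A F)) (principal (prodiscrete_entourage N A G))"
      by (intro bexI[of _ "F \<union> G"]) (simp_all add: anti)
  qed (auto simp: eventually_principal)
qed

lemma uniformly_continuous_prodiscrete_iff:
  assumes "\<tau> \<in> configs N A \<rightarrow> configs N B"
  shows "filterlim (\<lambda>(x, y). (\<tau> x, \<tau> y)) (prodiscrete_uniformity N B) (prodiscrete_uniformity N A)
    \<longleftrightarrow> (\<forall>F. finite F \<and> F \<subseteq> carrier N \<longrightarrow> (\<exists>E. finite E \<and> E \<subseteq> carrier N \<and>
          (\<forall>x\<in>configs N A. \<forall>y\<in>configs N A.
             (\<forall>n\<in>E. x n = y n) \<longrightarrow> (\<forall>n\<in>F. \<tau> x n = \<tau> y n))))"
proof -
  have r: "restrict x F = restrict y F \<longleftrightarrow> (\<forall>n\<in>F. x n = y n)"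
    for x y :: "'x \<Rightarrow> 'y" and F
    by (auto simp: fun_eq_iff restrict_def)
  have "filterlim (\<lambda>(x, y). (\<tau> x, \<tau> y)) (prodiscrete_uniformity N B) (prodiscrete_uniformity N A)
    \<longleftrightarrow> (\<forall>F\<in>{F. finite F \<and> F \<subseteq> carrier N}. eventually
          (\<lambda>(x, y). (\<tau> x, \<tau> y) \<in> prodiscrete_entourage N B F) (prodiscrete_uniformity N A))"
    unfolding prodiscrete_uniformity_def[of N B]
    by (simp add: filterlim_INF filterlim_principal case_prod_unfold)
  moreover have "(\<forall>p\<in>prodiscrete_entourage N A E.
        case p of (x, y) \<Rightarrow> (\<tau> x, \<tau> y) \<in> prodiscrete_entourage N B F) \<longleftrightarrow>
      (\<forall>x\<in>configs N A. \<forall>y\<in>configs N A.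
         (\<forall>n\<in>E. x n = y n) \<longrightarrow> (\<forall>n\<in>F. \<tau> x n = \<tau> y n))" for E F
    using assms by (auto simp: prodiscrete_entourage_def r Pi_iff)
  ultimately show ?thesis
    unfolding eventually_prodiscrete_uniformity by simp
qed

lemma surjunctiveD:
  fixes A :: "'c set"
  assumes N: "monoid N" and surj: "surjunctive N" and fin: "finite A"
    and ca: "cellular_automaton N A \<tau>" and inj: "inj_on \<tau> (configs N A)"
  shows "\<tau> ` configs N A = configs N A"
proof -
  interpret monoid N by fact
  obtain f :: "'c \<Rightarrow> nat" where f: "inj_on f A"
    using finite_imp_inj_to_nat_seg[OF fin] by auto
  define B where "B = f ` A"
  define g where "g = inv_into A f"
  have gf: "g (f a) = a" if "a \<in> A" for a
    using that f by (simp add: g_def)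
  have fg: "f (g b) = b" "g b \<in> A" if "b \<in> B" for b
    using that by (auto simp: g_def B_def f_inv_into_f inv_into_into)
  define \<phi> where "\<phi> x = (\<lambda>n\<in>carrier N. f (x n))" for x :: "'a \<Rightarrow> 'c"
  define \<psi> where "\<psi> y = (\<lambda>n\<in>carrier N. g (y n))" for y :: "'a \<Rightarrow> nat"
  have \<phi>: "\<phi> x \<in> configs N B" if "x \<in> configs N A" for x
    using that by (auto simp: \<phi>_def configs_def B_def)
  have \<psi>: "\<psi> y \<in> configs N A" if "y \<in> configs N B" for y
    using that fg by (auto simp: \<psi>_def configs_def)
  have \<psi>\<phi>: "\<psi> (\<phi> x) = x" if "x \<in> configs N A" for x
    using that gf by (auto simp: \<phi>_def \<psi>_def configs_def fun_eq_iff PiE_iff extensional_def)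
  have \<phi>\<psi>: "\<phi> (\<psi> y) = y" if "y \<in> configs N B" for y
    using that fg by (auto simp: \<phi>_def \<psi>_def configs_def fun_eq_iff PiE_iff extensional_def)
  have s\<phi>: "\<phi> (shift N n x) = shift N n (\<phi> x)" if "n \<in> carrier N" for n x
    using that by (auto simp: \<phi>_def shift_def fun_eq_iff)
  have s\<psi>: "\<psi> (shift N n x) = shift N n (\<psi> x)" if "n \<in> carrier N" for n x
    using that by (auto simp: \<psi>_def shift_def fun_eq_iff)
  have \<tau>: "\<tau> x \<in> configs N A" if "x \<in> configs N A" for x
    using ca that by (auto simp: cellular_automaton_def)
  define \<sigma> where "\<sigma> y = \<phi> (\<tau> (\<psi> y))" for y
  have \<sigma>: "\<sigma> \<in> configs N B \<rightarrow> configs N B"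
    using \<phi> \<psi> \<tau> by (auto simp: \<sigma>_def)
  have "\<sigma> (shift N n y) = shift N n (\<sigma> y)" if "n \<in> carrier N" "y \<in> configs N B" for n y
    using that ca \<psi>[of y] by (simp add: \<sigma>_def s\<phi> s\<psi> cellular_automaton_def)
  moreover have "filterlim (\<lambda>(x, y). (\<sigma> x, \<sigma> y))
      (prodiscrete_uniformity N B) (prodiscrete_uniformity N B)"
    unfolding uniformly_continuous_prodiscrete_iff[OF \<sigma>]
  proof (intro allI impI)
    fix F assume F: "finite F \<and> F \<subseteq> carrier N"
    have "\<tau> \<in> configs N A \<rightarrow> configs N A" using \<tau> by blast
    from uniformly_continuous_prodiscrete_iff[OF this] ca
    have "\<forall>F. finite F \<and> F \<subseteq> carrier N \<longrightarrow> (\<exists>E. finite E \<and> E \<subseteq> carrier N \<and>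
        (\<forall>x\<in>configs N A. \<forall>y\<in>configs N A.
           (\<forall>n\<in>E. x n = y n) \<longrightarrow> (\<forall>n\<in>F. \<tau> x n = \<tau> y n)))"
      unfolding cellular_automaton_def by (elim conjE) (rule iffD1)
    from this[rule_format, OF F] obtain E where E: "finite E" "E \<subseteq> carrier N"
      and EF: "\<forall>x\<in>configs N A. \<forall>y\<in>configs N A.
           (\<forall>n\<in>E. x n = y n) \<longrightarrow> (\<forall>n\<in>F. \<tau> x n = \<tau> y n)"
      by (elim exE conjE)
    have "\<forall>n\<in>F. \<sigma> x n = \<sigma> y n"
      if xy: "x \<in> configs N B" "y \<in> configs N B" "\<forall>n\<in>E. x n = y n" for x y
    proof -
      have "\<forall>n\<in>E. \<psi> x n = \<psi> y n" using xy(3) by (simp add: \<psi>_def restrict_def)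
      then have "\<forall>n\<in>F. \<tau> (\<psi> x) n = \<tau> (\<psi> y) n"
        by (rule EF[THEN bspec, OF \<psi>[OF xy(1)], THEN bspec, OF \<psi>[OF xy(2)], THEN mp])
      then show ?thesis by (simp add: \<sigma>_def \<phi>_def restrict_def)
    qed
    note * = this
    show "\<exists>E. finite E \<and> E \<subseteq> carrier N \<and> (\<forall>x\<in>configs N B. \<forall>y\<in>configs N B.
        (\<forall>n\<in>E. x n = y n) \<longrightarrow> (\<forall>n\<in>F. \<sigma> x n = \<sigma> y n))"
      by (intro exI[of _ E] conjI E) (intro ballI impI, rule *[THEN bspec])
  qed
  ultimately have "cellular_automaton N B \<sigma>"
    using \<sigma> by (simp add: cellular_automaton_def)
  moreover have "inj_on \<sigma> (configs N B)"
  proof (rule inj_onI)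
    fix x y assume xy: "x \<in> configs N B" "y \<in> configs N B" "\<sigma> x = \<sigma> y"
    then have "\<tau> (\<psi> x) = \<tau> (\<psi> y)" unfolding \<sigma>_def by (metis \<psi>\<phi> \<tau> \<psi>)
    then have "\<psi> x = \<psi> y" using inj \<psi> xy by (meson inj_onD)
    then show "x = y" using \<phi>\<psi> xy by metis
  qed
  moreover have "finite B" using fin by (simp add: B_def)
  ultimately have *: "\<sigma> ` configs N B = configs N B"
    using surj unfolding surjunctive_def by blast
  show ?thesis
  proof (intro equalityI subsetI)
    fix x assume x: "x \<in> configs N A"
    then obtain y where "y \<in> configs N B" "\<phi> x = \<sigma> y" using * \<phi> by blast
    then have "x = \<tau> (\<psi> y)" unfolding \<sigma>_def by (metis \<psi>\<phi> \<tau> \<psi> x)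
    then show "x \<in> \<tau> ` configs N A" using \<psi> \<open>y \<in> configs N B\<close> by blast
  qed (use \<tau> in blast)
qed

end

theory Submission
  imports Defs
begin

text \<open>By compactness, an injective cellular automaton \<open>\<tau>\<close> with finite alphabet has a left inverse
  \<open>\<sigma>\<close> that is again a cellular automaton, and \<open>\<tau>\<close> is surjective iff \<open>\<tau> \<circ> \<sigma> = id\<close>. Failure of
  surjunctivity is thus witnessed by two local rules \<open>\<mu>\<close>, \<open>\<nu>\<close> for which \<open>\<sigma> \<circ> \<tau> = id\<close> but
  \<open>\<tau> \<circ> \<sigma> \<noteq> id\<close>. By equivariance both conditions need only be tested at the identity, where they
  involve finitely many products of memory elements. Hence for \<open>M / \<gamma>\<close> they depend only on the
  restriction of \<open>\<gamma>\<close> to a finite set, and failure of surjunctivity is an open condition.\<close>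

section \<open>Shifts and uniform continuity\<close>

lemma shift_in_configs:
  assumes "monoid N" "n \<in> carrier N" "x \<in> configs N A"
  shows "shift N n x \<in> configs N A"
proof -
  interpret monoid N by fact
  show ?thesis using assms(2,3) by (auto simp: shift_def configs_def PiE_iff)
qed

text \<open>Equivariance read at the identity, where the shift by \<open>n\<close> looks up the cell
  \<open>n\<close>. Conditions on all cells thus reduce to conditions at the identity for all
  configurations.\<close>

lemma cellular_automaton_at:
  assumes N: "monoid N" and ca: "cellular_automaton N A \<tau>"
    and n: "n \<in> carrier N" and x: "x \<in> configs N A"
  shows "\<tau> x n = \<tau> (shift N n x) \<one>\<^bsub>N\<^esub>"
proof -
  interpret monoid N by fact
  have "\<tau> (shift N n x) = shift N n (\<tau> x)"
    using ca n x by (simp add: cellular_automaton_def)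
  then show ?thesis using n by (simp add: shift_def)
qed

text \<open>Uniform continuity for the entourage of the single cell \<open>n\<close>:
  \<open>E\<close> is a memory set at \<open>n\<close>.\<close>

lemma cellular_automaton_memory:
  assumes ca: "cellular_automaton N A \<tau>" and n: "n \<in> carrier N"
  obtains E where "finite E" "E \<subseteq> carrier N"
    "\<And>x y. \<lbrakk>x \<in> configs N A; y \<in> configs N A; \<And>e. e \<in> E \<Longrightarrow> x e = y e\<rbrakk> \<Longrightarrow> \<tau> x n = \<tau> y n"
proof -
  have "\<tau> \<in> configs N A \<rightarrow> configs N A"
    using ca by (simp add: cellular_automaton_def)
  from uniformly_continuous_prodiscrete_iff[OF this] ca
  have "\<forall>F. finite F \<and> F \<subseteq> carrier N \<longrightarrow> (\<exists>E. finite E \<and> E \<subseteq> carrier N \<and>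
      (\<forall>x\<in>configs N A. \<forall>y\<in>configs N A.
         (\<forall>n\<in>E. x n = y n) \<longrightarrow> (\<forall>n\<in>F. \<tau> x n = \<tau> y n)))"
    unfolding cellular_automaton_def by (elim conjE) (rule iffD1)
  from this[rule_format, of "{n}"] n obtain E where "finite E" "E \<subseteq> carrier N"
    "\<forall>x\<in>configs N A. \<forall>y\<in>configs N A. (\<forall>e\<in>E. x e = y e) \<longrightarrow> \<tau> x n = \<tau> y n"
    by auto
  then show ?thesis by (intro that) blast+
qed

section \<open>Compactness\<close>

text \<open>Around each point of \<open>U\<close>, the cylinder fixing the coordinates in
  \<open>F\<close> is open and stays in \<open>U\<close>.\<close>

lemma openin_product_discrete_finite_coordinates:
  assumes F: "finite F" and U: "U \<subseteq> I \<rightarrow>\<^sub>E A"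
    and det: "\<And>z w. \<lbrakk>z \<in> U; w \<in> I \<rightarrow>\<^sub>E A; \<And>i. i \<in> F \<Longrightarrow> z i = w i\<rbrakk> \<Longrightarrow> w \<in> U"
  shows "openin (product_topology (\<lambda>_. discrete_topology A) I) U"
proof (subst openin_subopen, intro ballI)
  fix z assume z: "z \<in> U"
  then have zI: "z \<in> I \<rightarrow>\<^sub>E A" using U by blast
  define V where "V = Pi\<^sub>E I (\<lambda>i. if i \<in> F then {z i} else A)"
  have "openin (product_topology (\<lambda>_. discrete_topology A) I) V"
    unfolding V_def using zI F
    by (subst openin_PiE_gen) (auto intro: finite_subset[OF _ F] simp: PiE_iff)
  moreover have "z \<in> V" using zI by (auto simp: V_def PiE_iff)
  moreover have "V \<subseteq> U"
  proof
    fix w assume w: "w \<in> V"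
    have wI: "w i \<in> (if i \<in> F then {z i} else A)" if "i \<in> I" for i
      using w that unfolding V_def by (rule PiE_mem)
    have ext: "w \<in> extensional I" using w by (simp add: V_def PiE_iff)
    have "w \<in> I \<rightarrow>\<^sub>E A"
      unfolding PiE_iff using wI zI ext by (metis PiE_mem singletonD)
    \<comment> \<open>\<open>F\<close> may leave \<open>I\<close>; there both functions are
      \<open>undefined\<close> by extensionality.\<close>
    moreover have "z i = w i" if "i \<in> F" for i
      using wI[of i] that zI ext by (cases "i \<in> I") (auto simp: PiE_iff extensional_def)
    ultimately show "w \<in> U" using det z by blast
  qed
  ultimately show "\<exists>T. openin (product_topology (\<lambda>_. discrete_topology A) I) T \<and> z \<in> T \<and> T \<subseteq> U"
    by blast
qed

text \<open>This gives the left inverse of \<open>\<tau>\<close> a finite memory set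
  \<open>T\<close>. By injectivity, \<open>\<tau>\<close> separates at some cell each pair with
  different values at the identity; by compactness of the space of pairs, finitely many cells
  suffice.\<close>

lemma injective_cellular_automaton_inverse_memory:
  assumes N: "monoid N" and ca: "cellular_automaton N A \<tau>" and fin: "finite A"
    and inj: "inj_on \<tau> (configs N A)"
  obtains T where "finite T" "T \<subseteq> carrier N"
    "\<And>x y. \<lbrakk>x \<in> configs N A; y \<in> configs N A; \<And>t. t \<in> T \<Longrightarrow> \<tau> x t = \<tau> y t\<rbrakk>
       \<Longrightarrow> x \<one>\<^bsub>N\<^esub> = y \<one>\<^bsub>N\<^esub>"
proof -
  interpret monoid N by fact
  define I where "I = carrier N"
  \<comment> \<open>A pair of configurations is coded as one configuration over
    \<open>A \<times> A\<close>, so that pairs form a single product of finite discrete spaces;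
    \<open>p\<close> and \<open>q\<close> decode it.\<close>
  define X where "X = product_topology (\<lambda>_. discrete_topology (A \<times> A)) I"
  have top: "topspace X = I \<rightarrow>\<^sub>E A \<times> A" by (simp add: X_def)
  have comp: "compact_space X"
    unfolding X_def using fin by (simp add: compact_space_product_topology compact_space_discrete_topology)
  define p where "p z = (\<lambda>n\<in>I. fst (z n))" for z :: "'a \<Rightarrow> 'c \<times> 'c"
  define q where "q z = (\<lambda>n\<in>I. snd (z n))" for z :: "'a \<Rightarrow> 'c \<times> 'c"
  have pq: "p z \<in> configs N A" "q z \<in> configs N A" if "z \<in> topspace X" for z
    using that unfolding top by (auto simp: p_def q_def configs_def I_def PiE_iff mem_Times_iff)
  \<comment> \<open>\<open>U t\<close> holds the pairs for which the cell \<open>t\<close> suffices: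
    the images differ at \<open>t\<close>, or there is nothing to separate at the identity.\<close>
  define U where
    "U t = {z \<in> topspace X. \<tau> (p z) t \<noteq> \<tau> (q z) t \<or> p z \<one>\<^bsub>N\<^esub> = q z \<one>\<^bsub>N\<^esub>}" for t
  have U_open: "openin X (U t)" if t: "t \<in> I" for t
  proof -
    obtain E where E: "finite E" "E \<subseteq> carrier N"
      "\<And>x y. \<lbrakk>x \<in> configs N A; y \<in> configs N A; \<And>e. e \<in> E \<Longrightarrow> x e = y e\<rbrakk> \<Longrightarrow> \<tau> x t = \<tau> y t"
      using cellular_automaton_memory[OF ca, of t] t unfolding I_def by blast
    show ?thesis
      unfolding X_def
    proof (rule openin_product_discrete_finite_coordinates)
      show "finite (insert \<one>\<^bsub>N\<^esub> E)" using E by simp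
      show "U t \<subseteq> I \<rightarrow>\<^sub>E A \<times> A" using top by (auto simp: U_def)
    next
      fix z w assume z: "z \<in> U t" and w: "w \<in> I \<rightarrow>\<^sub>E A \<times> A"
        and eq: "\<And>i. i \<in> insert \<one>\<^bsub>N\<^esub> E \<Longrightarrow> z i = w i"
      have zt: "z \<in> topspace X" and wt: "w \<in> topspace X" using z w top by (auto simp: U_def)
      have "\<tau> (p z) t = \<tau> (p w) t" "\<tau> (q z) t = \<tau> (q w) t"
        by (rule E(3)[OF pq(1)[OF zt] pq(1)[OF wt]], simp add: p_def restrict_def eq)
          (rule E(3)[OF pq(2)[OF zt] pq(2)[OF wt]], simp add: q_def restrict_def eq)
      moreover have "p z \<one>\<^bsub>N\<^esub> = p w \<one>\<^bsub>N\<^esub>" "q z \<one>\<^bsub>N\<^esub> = q w \<one>\<^bsub>N\<^esub>"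
        using eq by (auto simp: p_def q_def restrict_def)
      ultimately show "w \<in> U t" using z wt by (simp add: U_def)
    qed
  qed
  have "topspace X \<subseteq> \<Union>(U ` I)"
  proof
    fix z assume z: "z \<in> topspace X"
    show "z \<in> \<Union>(U ` I)"
    proof (cases "p z = q z")
      case True
      then show ?thesis using z by (auto simp: U_def I_def intro!: bexI[of _ "\<one>\<^bsub>N\<^esub>"])
    next
      case False
      then have ne: "\<tau> (p z) \<noteq> \<tau> (q z)" using inj pq[OF z] by (meson inj_onD)
      have "\<tau> (p z) \<in> carrier N \<rightarrow>\<^sub>E A" "\<tau> (q z) \<in> carrier N \<rightarrow>\<^sub>E A"
        using ca pq[OF z] by (auto simp: cellular_automaton_def configs_def)
      with ne obtain t where "t \<in> I" "\<tau> (p z) t \<noteq> \<tau> (q z) t"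
        unfolding I_def by (meson PiE_ext)
      then show ?thesis using z by (auto simp: U_def)
    qed
  qed
  moreover have "\<forall>V\<in>U ` I. openin X V" using U_open by blast
  ultimately obtain \<F> where \<F>: "finite \<F>" "\<F> \<subseteq> U ` I" "topspace X \<subseteq> \<Union>\<F>"
    using comp unfolding compact_space_alt by meson
  obtain T where T: "finite T" "T \<subseteq> I" "\<F> = U ` T"
    using finite_subset_image[OF \<F>(1,2)] by blast
  show ?thesis
  proof (rule that[of T])
    show "finite T" "T \<subseteq> carrier N" using T by (auto simp: I_def)
  next
    fix x y assume x: "x \<in> configs N A" and y: "y \<in> configs N A"
      and eq: "\<And>t. t \<in> T \<Longrightarrow> \<tau> x t = \<tau> y t"
    \<comment> \<open>The coded pair lies in some \<open>U t\<close> with \<open>t \<in> T\<close>;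
      as the images agree on \<open>T\<close>, only the second disjunct remains.\<close>
    define z where "z = (\<lambda>n\<in>I. (x n, y n))"
    have "z \<in> topspace X"
      unfolding top using x y by (auto simp: z_def configs_def I_def PiE_iff)
    moreover have "p z = x" "q z = y"
      using x y by (auto simp: z_def p_def q_def configs_def I_def PiE_iff extensional_def fun_eq_iff)
    ultimately show "x \<one>\<^bsub>N\<^esub> = y \<one>\<^bsub>N\<^esub>"
      using \<F>(3) T(3) eq by (auto simp: U_def)
  qed
qed

section \<open>Local rules\<close>

text \<open>A rule acts on functions on the whole type and the first clause makes it blind outside
  \<open>S\<close>, so patterns never have to be restricted to \<open>S\<close>.\<close>

definition local_rule :: "'m set \<Rightarrow> 'c set \<Rightarrow> (('m \<Rightarrow> 'c) \<Rightarrow> 'c) \<Rightarrow> bool" where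
  "local_rule S A \<mu> \<longleftrightarrow>
     (\<forall>p q. (\<forall>s\<in>S. p s = q s) \<longrightarrow> \<mu> p = \<mu> q) \<and>
     (\<forall>p. (\<forall>s\<in>S. p s \<in> A) \<longrightarrow> \<mu> p \<in> A)"

lemma local_rule_cong:
  "local_rule S A \<mu> \<Longrightarrow> (\<And>s. s \<in> S \<Longrightarrow> p s = q s) \<Longrightarrow> \<mu> p = \<mu> q"
  by (simp add: local_rule_def)

lemma local_rule_in:
  "local_rule S A \<mu> \<Longrightarrow> (\<And>s. s \<in> S \<Longrightarrow> p s \<in> A) \<Longrightarrow> \<mu> p \<in> A"
  by (simp add: local_rule_def)

text \<open>By \<open>det\<close>, \<open>v\<close> factors through the finite data
  \<open>d x\<close> on \<open>T\<close>; the factor is the rule, with its cells lifted along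
  \<open>h\<close> from \<open>D\<close> to \<open>C\<close>. It yields the rule of an automaton
  (\<open>d x = x\<close>) and of its inverse (\<open>d x = \<tau> x\<close>).\<close>

lemma local_rule_exists:
  assumes h: "h ` C = D" and T: "finite T" "T \<subseteq> D" and A: "A \<noteq> {}"
    and v: "\<And>x. x \<in> X \<Longrightarrow> v x \<in> A"
    and det: "\<And>x y. \<lbrakk>x \<in> X; y \<in> X; \<And>t. t \<in> T \<Longrightarrow> d x t = d y t\<rbrakk> \<Longrightarrow> v x = v y"
  obtains S \<mu> where "finite S" "S \<subseteq> C" "local_rule S A \<mu>"
    "\<And>x. x \<in> X \<Longrightarrow> v x = \<mu> (\<lambda>s. d x (h s))"
proof -
  obtain a where a: "a \<in> A" using A by blast
  define r where "r = inv_into C h"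
  have r: "r t \<in> C" "h (r t) = t" if "t \<in> T" for t
    using that T h by (auto simp: r_def inv_into_into f_inv_into_f)
  define P where "P p x \<longleftrightarrow> x \<in> X \<and> (\<forall>t\<in>T. d x t = p (r t))" for p x
  \<comment> \<open>Any \<open>x\<close> matching the pattern may be evaluated, by
    \<open>det\<close>; unmatched patterns get the default \<open>a\<close>, which keeps all values
    in \<open>A\<close>.\<close>
  define \<mu> where "\<mu> p = (if \<exists>x. P p x then v (SOME x. P p x) else a)" for p
  show ?thesis
  proof (rule that[of "r ` T" \<mu>])
    show "finite (r ` T)" "r ` T \<subseteq> C" using T r by auto
  next
    have "\<mu> p = \<mu> q" if "\<forall>s\<in>r ` T. p s = q s" for p q
    proof -
      have "P p = P q" using that by (auto simp: P_def fun_eq_iff)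
      then show ?thesis by (simp add: \<mu>_def)
    qed
    moreover have "\<mu> p \<in> A" for p
      using someI_ex[of "P p"] v a by (auto simp: \<mu>_def P_def)
    ultimately show "local_rule (r ` T) A \<mu>" by (simp add: local_rule_def)
  next
    fix x assume x: "x \<in> X"
    let ?p = "\<lambda>s. d x (h s)"
    have ex: "P ?p x" using x r by (simp add: P_def)
    then have "P ?p (SOME x. P ?p x)" by (rule someI)
    then have "v x = v (SOME x. P ?p x)"
      using r by (intro det x) (auto simp: P_def)
    then show "v x = \<mu> ?p" using ex by (auto simp: \<mu>_def)
  qed
qed

text \<open>Memory sets are taken in \<open>M\<close> rather than in its image \<open>N\<close> under \<open>h\<close>, so that one pair of
  rules can be used for all quotients of \<open>M\<close> at once.\<close>

definition rule_map ::
    "('n, 'b) monoid_scheme \<Rightarrow> ('m \<Rightarrow> 'n) \<Rightarrow> (('m \<Rightarrow> 'c) \<Rightarrow> 'c) \<Rightarrow> ('n \<Rightarrow> 'c) \<Rightarrow> ('n \<Rightarrow> 'c)" where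
  "rule_map N h \<mu> x = (\<lambda>n\<in>carrier N. \<mu> (\<lambda>s. x (h s \<otimes>\<^bsub>N\<^esub> n)))"

lemma rule_map_in_configs:
  assumes "monoid N" "local_rule S A \<mu>" "h ` S \<subseteq> carrier N" "x \<in> configs N A"
  shows "rule_map N h \<mu> x \<in> configs N A"
proof -
  interpret monoid N by fact
  have "x m \<in> A" if "m \<in> carrier N" for m
    using assms(4) that by (auto simp: configs_def)
  moreover have "h s \<in> carrier N" if "s \<in> S" for s
    using that assms(3) by blast
  ultimately have "\<mu> (\<lambda>s. x (h s \<otimes>\<^bsub>N\<^esub> n)) \<in> A" if "n \<in> carrier N" for n
    using that by (intro local_rule_in[OF assms(2)]) simp
  then show ?thesis by (auto simp: rule_map_def configs_def)
qed

text \<open>Rules multiply a cell from the left and shifts from the right, so associativity makes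
  them commute.\<close>

lemma rule_map_shift:
  assumes "monoid N" "local_rule S A \<mu>" "h ` S \<subseteq> carrier N" "n \<in> carrier N"
  shows "rule_map N h \<mu> (shift N n x) = shift N n (rule_map N h \<mu> x)"
proof
  interpret monoid N by fact
  fix m
  show "rule_map N h \<mu> (shift N n x) m = shift N n (rule_map N h \<mu> x) m"
  proof (cases "m \<in> carrier N")
    case True
    have "\<mu> (\<lambda>s. shift N n x (h s \<otimes>\<^bsub>N\<^esub> m)) = \<mu> (\<lambda>s. x (h s \<otimes>\<^bsub>N\<^esub> (m \<otimes>\<^bsub>N\<^esub> n)))"
    proof (rule local_rule_cong[OF assms(2)])
      fix s assume "s \<in> S"
      then have "h s \<in> carrier N" using assms(3) by blast
      then show "shift N n x (h s \<otimes>\<^bsub>N\<^esub> m) = x (h s \<otimes>\<^bsub>N\<^esub> (m \<otimes>\<^bsub>N\<^esub> n))"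
        using True assms(4) by (simp add: shift_def m_assoc)
    qed
    then show ?thesis using True assms(4) by (simp add: rule_map_def shift_def)
  qed (simp add: rule_map_def shift_def)
qed

lemma cellular_automaton_rule_map:
  assumes N: "monoid N" and \<mu>: "local_rule S A \<mu>" and S: "h ` S \<subseteq> carrier N" "finite S"
  shows "cellular_automaton N A (rule_map N h \<mu>)"
proof -
  interpret monoid N by fact
  have maps: "rule_map N h \<mu> \<in> configs N A \<rightarrow> configs N A"
    using rule_map_in_configs[OF N \<mu> S(1)] by blast
  have "filterlim (\<lambda>(x, y). (rule_map N h \<mu> x, rule_map N h \<mu> y))
      (prodiscrete_uniformity N A) (prodiscrete_uniformity N A)"
    unfolding uniformly_continuous_prodiscrete_iff[OF maps]
  proof (intro allI impI)
    fix F assume F: "finite F \<and> F \<subseteq> carrier N"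
    define E where "E = (\<lambda>(s, n). h s \<otimes>\<^bsub>N\<^esub> n) ` (S \<times> F)"
    have E: "finite E" "E \<subseteq> carrier N" using F S by (auto simp: E_def)
    have "rule_map N h \<mu> x n = rule_map N h \<mu> y n" if eq: "\<forall>n\<in>E. x n = y n" and n: "n \<in> F" for x y n
    proof -
      have "\<mu> (\<lambda>s. x (h s \<otimes>\<^bsub>N\<^esub> n)) = \<mu> (\<lambda>s. y (h s \<otimes>\<^bsub>N\<^esub> n))"
        using eq n by (intro local_rule_cong[OF \<mu>]) (auto simp: E_def)
      then show ?thesis by (simp add: rule_map_def restrict_def)
    qed
    then show "\<exists>E. finite E \<and> E \<subseteq> carrier N \<and> (\<forall>x\<in>configs N A. \<forall>y\<in>configs N A.
        (\<forall>n\<in>E. x n = y n) \<longrightarrow> (\<forall>n\<in>F. rule_map N h \<mu> x n = rule_map N h \<mu> y n))"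
      using E by blast
  qed
  then show ?thesis
    using maps rule_map_shift[OF N \<mu> S(1)] by (simp add: cellular_automaton_def)
qed

text \<open>As \<open>h\<close> is multiplicative, the composite reads \<open>x\<close> at
  \<open>h (s \<otimes> t) \<otimes> n\<close>, with the memory element of the inner rule on the
  left. It is thus governed by products in \<open>M\<close>, tested at the identity on the shifted
  configuration.\<close>

lemma rule_map_rule_map_at:
  assumes M: "monoid M" and N: "monoid N" and h: "h \<in> hom M N"
    and \<mu>: "local_rule S A \<mu>" "S \<subseteq> carrier M" and \<nu>: "local_rule T A \<nu>" "T \<subseteq> carrier M"
    and n: "n \<in> carrier N"
  shows "rule_map N h \<nu> (rule_map N h \<mu> x) n = \<nu> (\<lambda>t. \<mu> (\<lambda>s. shift N n x (h (s \<otimes>\<^bsub>M\<^esub> t))))"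
proof -
  interpret M: monoid M by fact
  interpret N: monoid N by fact
  have hN: "h m \<in> carrier N" if "m \<in> carrier M" for m
    using h that by (auto simp: hom_def)
  have "\<nu> (\<lambda>t. rule_map N h \<mu> x (h t \<otimes>\<^bsub>N\<^esub> n)) =
      \<nu> (\<lambda>t. \<mu> (\<lambda>s. shift N n x (h (s \<otimes>\<^bsub>M\<^esub> t))))"
  proof (rule local_rule_cong[OF \<nu>(1)])
    fix t assume "t \<in> T"
    then have t: "t \<in> carrier M" using \<nu>(2) by blast
    have "\<mu> (\<lambda>s. x (h s \<otimes>\<^bsub>N\<^esub> (h t \<otimes>\<^bsub>N\<^esub> n))) = \<mu> (\<lambda>s. shift N n x (h (s \<otimes>\<^bsub>M\<^esub> t)))"
    proof (rule local_rule_cong[OF \<mu>(1)])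
      fix s assume "s \<in> S"
      then have s: "s \<in> carrier M" using \<mu>(2) by blast
      show "x (h s \<otimes>\<^bsub>N\<^esub> (h t \<otimes>\<^bsub>N\<^esub> n)) = shift N n x (h (s \<otimes>\<^bsub>M\<^esub> t))"
        using s t n hN h by (simp add: shift_def hom_mult N.m_assoc)
    qed
    then show "rule_map N h \<mu> x (h t \<otimes>\<^bsub>N\<^esub> n) = \<mu> (\<lambda>s. shift N n x (h (s \<otimes>\<^bsub>M\<^esub> t)))"
      using t n hN by (simp add: rule_map_def)
  qed
  then show ?thesis using n by (simp add: rule_map_def)
qed

section \<open>Finite witnesses of failure of surjunctivity\<close>

text \<open>For the maps \<tau>, \<sigma> of the rules \<open>\<mu>\<close>, \<open>\<nu>\<close>,
  the clauses are \<sigma> \<circ> \<tau> = id and \<tau> \<circ> \<sigma> \<noteq> id, both at the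
  identity. Products are formed in \<open>M\<close> before \<open>h\<close> is applied, which allows
  comparison across quotients.\<close>

definition nonsurjunctive_witness ::
    "('m, 'b) monoid_scheme \<Rightarrow> ('n, 'd) monoid_scheme \<Rightarrow> ('m \<Rightarrow> 'n) \<Rightarrow> 'c set \<Rightarrow>
     (('m \<Rightarrow> 'c) \<Rightarrow> 'c) \<Rightarrow> (('m \<Rightarrow> 'c) \<Rightarrow> 'c) \<Rightarrow> bool" where
  "nonsurjunctive_witness M N h A \<mu> \<nu> \<longleftrightarrow>
     (\<forall>x\<in>configs N A. \<nu> (\<lambda>t. \<mu> (\<lambda>s. x (h (s \<otimes>\<^bsub>M\<^esub> t)))) = x (h \<one>\<^bsub>M\<^esub>)) \<and>
     (\<exists>y\<in>configs N A. \<mu> (\<lambda>s. \<nu> (\<lambda>t. y (h (t \<otimes>\<^bsub>M\<^esub> s)))) \<noteq> y (h \<one>\<^bsub>M\<^esub>))"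

text \<open>\<open>\<mu>\<close> describes an injective, non-surjective \<open>\<tau>\<close>, and
  \<open>\<nu>\<close> a left inverse supplied by compactness; a configuration outside the image
  shows that it is not a right inverse.\<close>

lemma nonsurjunctive_witness_exists:
  assumes M: "monoid M" and N: "monoid N" and h: "h \<in> hom M N" "h ` carrier M = carrier N"
    and h1: "h \<one>\<^bsub>M\<^esub> = \<one>\<^bsub>N\<^esub>" and ns: "\<not> surjunctive N"
  obtains A :: "nat set" and S T \<mu> \<nu> where "finite A"
    "finite S" "S \<subseteq> carrier M" "local_rule S A \<mu>"
    "finite T" "T \<subseteq> carrier M" "local_rule T A \<nu>"
    "nonsurjunctive_witness M N h A \<mu> \<nu>"
proof -
  interpret M: monoid M by fact
  interpret N: monoid N by fact
  obtain A :: "nat set" and \<tau> where fin: "finite A" and ca: "cellular_automaton N A \<tau>"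
    and inj: "inj_on \<tau> (configs N A)" and nsurj: "\<tau> ` configs N A \<noteq> configs N A"
    using ns unfolding surjunctive_def by blast
  have \<tau>: "\<tau> x \<in> configs N A" if "x \<in> configs N A" for x
    using ca that by (auto simp: cellular_automaton_def)
  obtain y where y: "y \<in> configs N A" "y \<notin> \<tau> ` configs N A"
    using nsurj \<tau> by blast
  \<comment> \<open>The carrier contains the identity, so the existence of \<open>y\<close> excludes
    an empty alphabet.\<close>
  then have A: "A \<noteq> {}" by (auto simp: configs_def PiE_iff)
  have at1: "x \<one>\<^bsub>N\<^esub> \<in> A" if "x \<in> configs N A" for x
    using that by (auto simp: configs_def)
  obtain E where E: "finite E" "E \<subseteq> carrier N" "\<And>x y. \<lbrakk>x \<in> configs N A; y \<in> configs N A;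
      \<And>e. e \<in> E \<Longrightarrow> x e = y e\<rbrakk> \<Longrightarrow> \<tau> x \<one>\<^bsub>N\<^esub> = \<tau> y \<one>\<^bsub>N\<^esub>"
    using cellular_automaton_memory[OF ca N.one_closed] by blast
  obtain S \<mu> where S: "finite S" "S \<subseteq> carrier M" and \<mu>: "local_rule S A \<mu>"
    and \<mu>\<tau>: "\<And>x. x \<in> configs N A \<Longrightarrow> \<tau> x \<one>\<^bsub>N\<^esub> = \<mu> (\<lambda>s. x (h s))"
    using local_rule_exists[OF h(2) E(1,2) A, of "configs N A" "\<lambda>x. \<tau> x \<one>\<^bsub>N\<^esub>" "\<lambda>x. x"]
      \<tau> at1 E(3) by blast
  obtain G where G: "finite G" "G \<subseteq> carrier N" "\<And>x y. \<lbrakk>x \<in> configs N A; y \<in> configs N A;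
      \<And>t. t \<in> G \<Longrightarrow> \<tau> x t = \<tau> y t\<rbrakk> \<Longrightarrow> x \<one>\<^bsub>N\<^esub> = y \<one>\<^bsub>N\<^esub>"
    using injective_cellular_automaton_inverse_memory[OF N ca fin inj] by blast
  obtain T \<nu> where T: "finite T" "T \<subseteq> carrier M" and \<nu>: "local_rule T A \<nu>"
    and \<nu>\<tau>: "\<And>x. x \<in> configs N A \<Longrightarrow> x \<one>\<^bsub>N\<^esub> = \<nu> (\<lambda>t. \<tau> x (h t))"
    using local_rule_exists[OF h(2) G(1,2) A, of "configs N A" "\<lambda>x. x \<one>\<^bsub>N\<^esub>" \<tau>]
      at1 G(3) by blast
  have hN: "h m \<in> carrier N" if "m \<in> carrier M" for m
    using h(2) that by blast
  have ST: "h ` S \<subseteq> carrier N" "h ` T \<subseteq> carrier N" using S T hN by auto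
  have \<tau>_rule: "\<tau> x = rule_map N h \<mu> x" if x: "x \<in> configs N A" for x
  proof (rule PiE_ext)
    show "\<tau> x \<in> carrier N \<rightarrow>\<^sub>E A" using \<tau>[OF x] by (simp add: configs_def)
    show "rule_map N h \<mu> x \<in> carrier N \<rightarrow>\<^sub>E A"
      using rule_map_in_configs[OF N \<mu> ST(1) x] by (simp add: configs_def)
  next
    fix n assume n: "n \<in> carrier N"
    have "\<tau> x n = \<mu> (\<lambda>s. shift N n x (h s))"
      using cellular_automaton_at[OF N ca n x] \<mu>\<tau> shift_in_configs[OF N n x] by simp
    also have "\<dots> = \<mu> (\<lambda>s. x (h s \<otimes>\<^bsub>N\<^esub> n))"
      using S hN by (intro local_rule_cong[OF \<mu>]) (auto simp: shift_def)
    finally show "\<tau> x n = rule_map N h \<mu> x n" using n by (simp add: rule_map_def)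
  qed
  have shift1: "shift N \<one>\<^bsub>N\<^esub> x = x" if "x \<in> configs N A" for x
    using that by (auto simp: shift_def configs_def PiE_iff extensional_def fun_eq_iff)
  have "\<nu> (\<lambda>t. \<mu> (\<lambda>s. x (h (s \<otimes>\<^bsub>M\<^esub> t)))) = x (h \<one>\<^bsub>M\<^esub>)" if x: "x \<in> configs N A" for x
  proof -
    have "x \<one>\<^bsub>N\<^esub> = \<nu> (\<lambda>t. rule_map N h \<mu> x (h t))"
      using \<nu>\<tau>[OF x] \<tau>_rule[OF x] by simp
    also have "\<dots> = \<nu> (\<lambda>t. rule_map N h \<mu> x (h t \<otimes>\<^bsub>N\<^esub> \<one>\<^bsub>N\<^esub>))"
      using T hN by (intro local_rule_cong[OF \<nu>]) auto
    also have "\<dots> = rule_map N h \<nu> (rule_map N h \<mu> x) \<one>\<^bsub>N\<^esub>"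
      by (simp add: rule_map_def[of N h \<nu>])
    also have "\<dots> = \<nu> (\<lambda>t. \<mu> (\<lambda>s. x (h (s \<otimes>\<^bsub>M\<^esub> t))))"
      using rule_map_rule_map_at[OF M N h(1) \<mu> S(2) \<nu> T(2) N.one_closed, of x] shift1[OF x] by simp
    finally show ?thesis using h1 by simp
  qed
  moreover have "\<exists>y\<in>configs N A. \<mu> (\<lambda>s. \<nu> (\<lambda>t. y (h (t \<otimes>\<^bsub>M\<^esub> s)))) \<noteq> y (h \<one>\<^bsub>M\<^esub>)"
  proof -
    \<comment> \<open>\<open>\<tau>\<close> cannot send \<open>?x\<close> to \<open>y\<close>, which
      is outside its image. So the two differ at some cell \<open>n\<close>, and the shift by
      \<open>n\<close> moves the difference to the identity.\<close>
    let ?x = "rule_map N h \<nu> y"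
    have x: "?x \<in> configs N A" by (rule rule_map_in_configs[OF N \<nu> ST(2) y(1)])
    then have "rule_map N h \<mu> ?x \<noteq> y" using y(2) \<tau>_rule[of ?x] by (metis imageI)
    moreover have "rule_map N h \<mu> ?x \<in> carrier N \<rightarrow>\<^sub>E A" "y \<in> carrier N \<rightarrow>\<^sub>E A"
      using rule_map_in_configs[OF N \<mu> ST(1) x] y(1) by (auto simp: configs_def)
    ultimately obtain n where n: "n \<in> carrier N" "rule_map N h \<mu> ?x n \<noteq> y n"
      by (meson PiE_ext)
    have "\<mu> (\<lambda>s. \<nu> (\<lambda>t. shift N n y (h (t \<otimes>\<^bsub>M\<^esub> s)))) \<noteq> shift N n y (h \<one>\<^bsub>M\<^esub>)"
      using n rule_map_rule_map_at[OF M N h(1) \<nu> T(2) \<mu> S(2) n(1), of y]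
      by (simp add: h1 shift_def)
    then show ?thesis using shift_in_configs[OF N n(1) y(1)] by blast
  qed
  ultimately have "nonsurjunctive_witness M N h A \<mu> \<nu>"
    by (simp add: nonsurjunctive_witness_def)
  then show ?thesis using that fin S \<mu> T \<nu> by blast
qed

text \<open>The first clause, applied to shifts, makes the map of \<open>\<nu>\<close> a left
  inverse of the map of \<open>\<mu>\<close>, which is then injective. Surjectivity would make this
  inverse two-sided, against the second clause.\<close>

lemma nonsurjunctive_witness_imp_not_surjunctive:
  fixes A :: "'c set"
  assumes M: "monoid M" and N: "monoid N" and h: "h \<in> hom M N"
    and h1: "h \<one>\<^bsub>M\<^esub> = \<one>\<^bsub>N\<^esub>" and fin: "finite A"
    and S: "finite S" "S \<subseteq> carrier M" and \<mu>: "local_rule S A \<mu>"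
    and T: "T \<subseteq> carrier M" and \<nu>: "local_rule T A \<nu>"
    and w: "nonsurjunctive_witness M N h A \<mu> \<nu>"
  shows "\<not> surjunctive N"
proof
  assume surj: "surjunctive N"
  interpret M: monoid M by fact
  interpret N: monoid N by fact
  have hN: "h m \<in> carrier N" if "m \<in> carrier M" for m
    using h that by (auto simp: hom_def)
  have ST: "h ` S \<subseteq> carrier N" "h ` T \<subseteq> carrier N" using S T hN by auto
  let ?\<tau> = "rule_map N h \<mu>" and ?\<sigma> = "rule_map N h \<nu>"
  have inv: "?\<sigma> (?\<tau> x) = x" if x: "x \<in> configs N A" for x
  proof (rule PiE_ext)
    show "x \<in> carrier N \<rightarrow>\<^sub>E A" using x by (simp add: configs_def)
    show "?\<sigma> (?\<tau> x) \<in> carrier N \<rightarrow>\<^sub>E A"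
      using rule_map_in_configs[OF N \<nu> ST(2) rule_map_in_configs[OF N \<mu> ST(1) x]]
      by (simp add: configs_def)
  next
    fix n assume n: "n \<in> carrier N"
    have "?\<sigma> (?\<tau> x) n = shift N n x (h \<one>\<^bsub>M\<^esub>)"
      using rule_map_rule_map_at[OF M N h \<mu> S(2) \<nu> T n, of x] w shift_in_configs[OF N n x]
      by (simp add: nonsurjunctive_witness_def)
    then show "?\<sigma> (?\<tau> x) n = x n" using n by (simp add: h1 shift_def)
  qed
  obtain y where y: "y \<in> configs N A"
    "\<mu> (\<lambda>s. \<nu> (\<lambda>t. y (h (t \<otimes>\<^bsub>M\<^esub> s)))) \<noteq> y (h \<one>\<^bsub>M\<^esub>)"
    using w by (auto simp: nonsurjunctive_witness_def)
  have "?\<tau> ` configs N A = configs N A"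
    by (rule surjunctiveD[OF N surj fin cellular_automaton_rule_map[OF N \<mu> ST(1) S(1)]])
      (metis inv inj_onI)
  then obtain x where x: "x \<in> configs N A" "y = ?\<tau> x" using y(1) by blast
  then have "?\<tau> (?\<sigma> y) \<one>\<^bsub>N\<^esub> = y \<one>\<^bsub>N\<^esub>" using inv by simp
  moreover have "shift N \<one>\<^bsub>N\<^esub> y = y"
    using y(1) by (auto simp: shift_def configs_def PiE_iff extensional_def fun_eq_iff)
  ultimately show False
    using y(2) rule_map_rule_map_at[OF M N h \<nu> T \<mu> S(2) N.one_closed, of y] h1 by simp
qed

section \<open>Transfer between quotients\<close>

lemma quotient_monoid_image:
  "(\<lambda>m. \<gamma> `` {m}) ` carrier M = carrier (quotient_monoid M \<gamma>)"
  by (auto simp: quotient_monoid_def quotient_def)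

lemma hom_quotient_monoid:
  assumes "congruence_on M \<gamma>"
  shows "(\<lambda>m. \<gamma> `` {m}) \<in> hom M (quotient_monoid M \<gamma>)"
proof (rule homI)
  show "\<gamma> `` {m} \<in> carrier (quotient_monoid M \<gamma>)" if "m \<in> carrier M" for m
    using that quotient_monoid_image[of \<gamma> M] by blast
qed (simp add: quotient_monoid_mult[OF assms])

text \<open>\<open>z\<close> is carried to \<open>\<gamma>\<close>-classes through representatives
  in \<open>P\<close>; the inclusion of \<open>\<gamma>\<close> in \<open>\<delta>\<close> on
  \<open>P\<close> makes the value independent of the representative.\<close>

lemma quotient_config_transfer:
  assumes \<gamma>: "congruence_on M \<gamma>" and \<delta>: "congruence_on M \<delta>"
    and P: "P \<subseteq> carrier M" "\<gamma> \<inter> P \<times> P \<subseteq> \<delta>" and A: "A \<noteq> {}"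
    and z: "z \<in> configs (quotient_monoid M \<delta>) A"
  obtains w where "w \<in> configs (quotient_monoid M \<gamma>) A"
    "\<And>p. p \<in> P \<Longrightarrow> w (\<gamma> `` {p}) = z (\<delta> `` {p})"
proof -
  have eq: "equiv (carrier M) \<gamma>" "equiv (carrier M) \<delta>"
    using \<gamma> \<delta> by (auto simp: congruence_on_def)
  obtain a where a: "a \<in> A" using A by blast
  define r where "r c = (SOME p. p \<in> P \<and> \<gamma> `` {p} = c)" for c
  \<comment> \<open>\<open>r c\<close> is a representative of \<open>c\<close> in \<open>P\<close>;
    classes without one get the default \<open>a\<close>.\<close>
  define w where "w = (\<lambda>c\<in>carrier (quotient_monoid M \<gamma>).
    if \<exists>p\<in>P. \<gamma> `` {p} = c then z (\<delta> `` {r c}) else a)"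
  have r: "r c \<in> P \<and> \<gamma> `` {r c} = c" if "\<exists>p\<in>P. \<gamma> `` {p} = c" for c
    using that unfolding r_def by (metis (mono_tags, lifting) someI_ex)
  have zA: "z (\<delta> `` {p}) \<in> A" if "p \<in> P" for p
    using z that P(1) quotient_monoid_image[of \<delta> M] by (auto simp: configs_def PiE_iff)
  show ?thesis
  proof (rule that[of w])
    show "w \<in> configs (quotient_monoid M \<gamma>) A"
      using r zA a by (auto simp: w_def configs_def)
  next
    fix p assume p: "p \<in> P"
    let ?c = "\<gamma> `` {p}"
    have rc: "r ?c \<in> P" "\<gamma> `` {r ?c} = ?c" using r[of ?c] p by auto
    then have "(r ?c, p) \<in> \<gamma>"
      using eq_equiv_class[OF rc(2) eq(1)] p P(1) by blast
    then have "(r ?c, p) \<in> \<delta>" using P(2) rc(1) p by blast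
    then have "\<delta> `` {r ?c} = \<delta> `` {p}" by (rule equiv_class_eq[OF eq(2)])
    moreover have "?c \<in> carrier (quotient_monoid M \<gamma>)"
      using p P(1) quotient_monoid_image[of \<gamma> M] by blast
    ultimately show "w ?c = z (\<delta> `` {p})" using p by (auto simp: w_def)
  qed
qed

text \<open>Both clauses read configurations only at classes of elements of \<open>P\<close>. For
  the universal clause, configurations over \<open>\<delta>\<close> are pulled back to
  \<open>\<gamma>\<close>; for the existential one, \<open>y\<close> is carried from
  \<open>\<gamma>\<close> to \<open>\<delta>\<close>. Each direction takes one inclusion of
  \<open>P(2)\<close>.\<close>

lemma nonsurjunctive_witness_transfer:
  assumes \<gamma>: "congruence_on M \<gamma>" and \<delta>: "congruence_on M \<delta>"
    and \<mu>: "local_rule S A \<mu>" and \<nu>: "local_rule T A \<nu>"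
    and P: "P \<subseteq> carrier M" "\<gamma> \<inter> P \<times> P = \<delta> \<inter> P \<times> P" "\<one>\<^bsub>M\<^esub> \<in> P"
    and ST: "\<And>s t. \<lbrakk>s \<in> S; t \<in> T\<rbrakk> \<Longrightarrow> s \<otimes>\<^bsub>M\<^esub> t \<in> P \<and> t \<otimes>\<^bsub>M\<^esub> s \<in> P"
    and w: "nonsurjunctive_witness M (quotient_monoid M \<gamma>) (\<lambda>m. \<gamma> `` {m}) A \<mu> \<nu>"
  shows "nonsurjunctive_witness M (quotient_monoid M \<delta>) (\<lambda>m. \<delta> `` {m}) A \<mu> \<nu>"
proof -
  let ?N = "quotient_monoid M"
  obtain y where y: "y \<in> configs (?N \<gamma>) A"
    "\<mu> (\<lambda>s. \<nu> (\<lambda>t. y (\<gamma> `` {t \<otimes>\<^bsub>M\<^esub> s}))) \<noteq> y (\<gamma> `` {\<one>\<^bsub>M\<^esub>})"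
    using w by (auto simp: nonsurjunctive_witness_def)
  have "\<gamma> `` {\<one>\<^bsub>M\<^esub>} \<in> carrier (?N \<gamma>)" using quotient_monoid_image[of \<gamma> M] P by blast
  then have A: "A \<noteq> {}" using y(1) by (auto simp: configs_def PiE_iff)
  \<comment> \<open>Stated for arbitrary rules, to serve for both orders of composition.\<close>
  have transfer: "\<nu>' (\<lambda>t. \<mu>' (\<lambda>s. u (\<gamma> `` {s \<otimes>\<^bsub>M\<^esub> t}))) = \<nu>' (\<lambda>t. \<mu>' (\<lambda>s. z (\<delta> `` {s \<otimes>\<^bsub>M\<^esub> t})))"
    if "local_rule S' A \<mu>'" "local_rule T' A \<nu>'" "\<And>s t. \<lbrakk>s \<in> S'; t \<in> T'\<rbrakk> \<Longrightarrow> s \<otimes>\<^bsub>M\<^esub> t \<in> P"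
      "\<And>p. p \<in> P \<Longrightarrow> u (\<gamma> `` {p}) = z (\<delta> `` {p})" for S' T' \<mu>' \<nu>' u z
    using that by (intro local_rule_cong[OF that(2)] local_rule_cong[OF that(1)]) simp
  have "\<nu> (\<lambda>t. \<mu> (\<lambda>s. z (\<delta> `` {s \<otimes>\<^bsub>M\<^esub> t}))) = z (\<delta> `` {\<one>\<^bsub>M\<^esub>})"
    if z: "z \<in> configs (?N \<delta>) A" for z
  proof -
    obtain u where u: "u \<in> configs (?N \<gamma>) A" "\<And>p. p \<in> P \<Longrightarrow> u (\<gamma> `` {p}) = z (\<delta> `` {p})"
      using quotient_config_transfer[OF \<gamma> \<delta> P(1) _ A z] P(2) by blast
    have "\<nu> (\<lambda>t. \<mu> (\<lambda>s. u (\<gamma> `` {s \<otimes>\<^bsub>M\<^esub> t}))) = u (\<gamma> `` {\<one>\<^bsub>M\<^esub>})"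
      using w u(1) by (simp add: nonsurjunctive_witness_def)
    then show ?thesis using transfer[of S \<mu> T \<nu> u z, OF \<mu> \<nu> _ u(2)] ST u(2)[OF P(3)] by simp
  qed
  moreover obtain z where z: "z \<in> configs (?N \<delta>) A" "\<And>p. p \<in> P \<Longrightarrow> z (\<delta> `` {p}) = y (\<gamma> `` {p})"
    using quotient_config_transfer[OF \<delta> \<gamma> P(1) _ A y(1)] P(2) by blast
  moreover have "\<mu> (\<lambda>s. \<nu> (\<lambda>t. z (\<delta> `` {t \<otimes>\<^bsub>M\<^esub> s}))) \<noteq> z (\<delta> `` {\<one>\<^bsub>M\<^esub>})"
    using y(2) transfer[of T \<nu> S \<mu> y z, OF \<nu> \<mu> _ z(2)[symmetric]] ST z(2)[OF P(3)] by simp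
  ultimately show ?thesis unfolding nonsurjunctive_witness_def by blast
qed

section \<open>Non-surjunctivity as an open condition\<close>

theorem theorem6p10:
  fixes M :: "('a, 'b) monoid_scheme"
  assumes "monoid M"
  shows "closedin (congruence_space M)
           {\<gamma> \<in> congruences M. surjunctive (quotient_monoid M \<gamma>)}"
proof -
  interpret monoid M by fact
  let ?N = "quotient_monoid M" and ?h = "\<lambda>\<gamma> m. \<gamma> `` {m}"
  have h1: "?h \<gamma> \<one>\<^bsub>M\<^esub> = \<one>\<^bsub>?N \<gamma>\<^esub>" for \<gamma>
    by (simp add: quotient_monoid_def)
  have "\<exists>F. finite F \<and> F \<subseteq> carrier M \<times> carrier M \<and>
      (\<forall>\<delta>\<in>congruences M. \<gamma> \<inter> F = \<delta> \<inter> F \<longrightarrow> \<not> surjunctive (?N \<delta>))"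
    if \<gamma>: "congruence_on M \<gamma>" and ns: "\<not> surjunctive (?N \<gamma>)" for \<gamma>
  proof -
    obtain A :: "nat set" and S T \<mu> \<nu> where A: "finite A"
      and S: "finite S" "S \<subseteq> carrier M" and \<mu>: "local_rule S A \<mu>"
      and T: "finite T" "T \<subseteq> carrier M" and \<nu>: "local_rule T A \<nu>"
      and w: "nonsurjunctive_witness M (?N \<gamma>) (?h \<gamma>) A \<mu> \<nu>"
      by (rule nonsurjunctive_witness_exists[OF assms monoid_quotient_monoid[OF assms \<gamma>]
        hom_quotient_monoid[OF \<gamma>] quotient_monoid_image h1 ns])
    \<comment> \<open>\<open>P\<close> contains every element whose class a witness reads: products
      in both orders, one for each composite, and the identity.\<close>
    define P where "P = insert \<one>\<^bsub>M\<^esub> ((\<lambda>(s, t). s \<otimes>\<^bsub>M\<^esub> t) ` (S \<times> T \<union> T \<times> S))"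
    have P: "finite P" "P \<subseteq> carrier M" "\<one>\<^bsub>M\<^esub> \<in> P"
      using S T by (auto simp: P_def)
    have ST: "s \<otimes>\<^bsub>M\<^esub> t \<in> P \<and> t \<otimes>\<^bsub>M\<^esub> s \<in> P" if "s \<in> S" "t \<in> T" for s t
      using that by (force simp: P_def)
    have "\<not> surjunctive (?N \<delta>)"
      if \<delta>: "congruence_on M \<delta>" and eq: "\<gamma> \<inter> P \<times> P = \<delta> \<inter> P \<times> P" for \<delta>
      by (rule nonsurjunctive_witness_imp_not_surjunctive[OF assms monoid_quotient_monoid[OF assms \<delta>]
        hom_quotient_monoid[OF \<delta>] h1 A S \<mu> T(2) \<nu>
        nonsurjunctive_witness_transfer[OF \<gamma> \<delta> \<mu> \<nu> P(2) eq P(3) ST w]])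
    \<comment> \<open>Agreement on \<open>P \<times> P\<close> is the basic neighbourhood of
      \<open>\<gamma>\<close> that \<open>openin_congruence_space\<close> asks for.\<close>
    then show ?thesis using P by (intro exI[of _ "P \<times> P"]) (auto simp: congruences_def)
  qed
  then have "openin (congruence_space M)
      (congruences M - {\<gamma> \<in> congruences M. surjunctive (?N \<gamma>)})"
    unfolding openin_congruence_space by (auto simp: congruences_def)
  then show ?thesis
    by (auto simp: closedin_def topspace_congruence_space)
qed

end
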